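(* Let $p$ be a prime, $d\ge 1$ an integer, and let $A:\mathbb{Z}_{\ge 0}^d\to \mathbb{Z}_p\setminus\{0\}$ and $g:\mathbb{Z}_{\ge 0}^d\to \mathbb{Z}_p\setminus\{0\}$ be maps satisfying: (i) $v_p\big(A(\mathbf 0)\big)=0$; (ii) $A(\mathbf n)\in g(\mathbf n)\mathbb{Z}_p$ for all $\mathbf n\in\mathbb{Z}_{\ge0}^d$; (iii) for all non-negative integers $s$ and all integer vectors $\mathbf v,\mathbf u,\mathbf n\in\mathbb{Z}^d$ with $\mathbf v,\mathbf u,\mathbf n\ge \mathbf 0$, $0\le v_i<p$ and $0\le u_i<p^s$ for $i=1,\dots,d$, $$\frac{A(\mathbf v +p\mathbf u+\mathbf n p^{s+1})}{A(\mathbf v +p\mathbf u)}- \frac{A(\mathbf u+\mathbf n p^s)}{A(\mathbf u)}\in p^{s+1} \,\frac{g(\mathbf n)}{g(\mathbf v +p\mathbf u)}\,\mathbb{Z}_p.$$ Extend $A$ to $\mathbb{Z}^d$ by setting $A(\mathbf n)=0$ whenever $n_i<0$ for some $i$. Then for all non-negative integers $s$ and all integer vectors $\mathbf m,\mathbf K,\mathbf a\in\mathbb{Z}^d$ with $\mathbf m\ge\mathbf 0$ and $0\le a_i<p$ for $i=1,\dots,d$, $$\sum_{p^s\mathbf m\le\mathbf k\le p^s(\mathbf m+\mathbf 1)-\mathbf 1} \big( A(\mathbf a +p\mathbf k)A(\mathbf K-\mathbf k)-A(\mathbf a +p(\mathbf K-\mathbf k))A(\mathbf k)\big)\in p^{s+1}g(\mathbf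 m)\mathbb{Z}_p,$$ where the sum runs over integer vectors $\mathbf k\in\mathbb{Z}^d$.
   Context: $\mathbb{Z}_p$ denotes the $p$-adic integers and $v_p$ the $p$-adic valuation. For vectors in $\mathbb{R}^d$, $\mathbf m\ge\mathbf n$ means $m_i\ge n_i$ for all $i$; sums and scalar multiples of vectors are componentwise; $\mathbf 0=(0,\dots,0)$ and $\mathbf 1=(1,\dots,1)$. *)

theory Defs
  imports
    "HOL-Analysis.Finite_Cartesian_Product"
    "HOL-Computational_Algebra.Fraction_Field"
    "HOL-Library.Extended_Nat"
    "HOL-Library.Set_Algebras"
    "Berlekamp_Zassenhaus.Finite_Field"
begin

text \<open>
  The ring of $p$-adic integers as the inverse limit of the rings $\mathbb{Z}/p^n\mathbb{Z}$,
  where $p$ is the cardinality of the index type. The residue modulo $p^n$ is represented by its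
  least non-negative representative, so the single equation below expresses both
  \<open>0 \<le> x n < p ^ n\<close> and the compatibility of the residues.
\<close>

typedef ('p::prime_card) padic_int =
  "{x :: nat \<Rightarrow> int. \<forall>n. x n = x (Suc n) mod int CARD('p) ^ n}"
  by (rule exI[of _ "\<lambda>_. 0"]) simp

setup_lifting type_definition_padic_int

lemma mod_power_Suc_mod: "(a::int) mod p ^ Suc n mod p ^ n = a mod p ^ n"
  by (rule mod_mod_cancel) (simp add: le_imp_power_dvd)

lemma mod_residue: "\<forall>n. x n = x (Suc n) mod p ^ n \<Longrightarrow> x n mod p ^ n = x (Suc n) mod (p::int) ^ n"
  by (metis mod_mod_trivial)

lemma padic_int_eqI: "(\<And>n. Rep_padic_int x n = Rep_padic_int y n) \<Longrightarrow> x = y"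
  by (simp add: Rep_padic_int_inject[symmetric] fun_eq_iff)

lemma padic_int_residue_mod_self [simp]:
  "Rep_padic_int (x :: 'p::prime_card padic_int) n mod int CARD('p) ^ n = Rep_padic_int x n"
proof -
  have "Rep_padic_int x n = Rep_padic_int x (Suc n) mod int CARD('p) ^ n"
    using Rep_padic_int[of x] by blast
  then show ?thesis by (metis mod_mod_trivial)
qed

instantiation padic_int :: (prime_card) comm_ring_1
begin

lift_definition zero_padic_int :: "'a padic_int" is "\<lambda>_. 0"
  by simp

lift_definition one_padic_int :: "'a padic_int" is "\<lambda>n. 1 mod int CARD('a) ^ n"
  by (simp only: mod_power_Suc_mod)

lift_definition plus_padic_int :: "'a padic_int \<Rightarrow> 'a padic_int \<Rightarrow> 'a padic_int"
  is "\<lambda>x y n. (x n + y n) mod int CARD('a) ^ n"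
  unfolding mod_power_Suc_mod by (blast intro: mod_add_cong mod_residue)

lift_definition times_padic_int :: "'a padic_int \<Rightarrow> 'a padic_int \<Rightarrow> 'a padic_int"
  is "\<lambda>x y n. (x n * y n) mod int CARD('a) ^ n"
  unfolding mod_power_Suc_mod by (blast intro: mod_mult_cong mod_residue)

lift_definition uminus_padic_int :: "'a padic_int \<Rightarrow> 'a padic_int"
  is "\<lambda>x n. (- x n) mod int CARD('a) ^ n"
  unfolding mod_power_Suc_mod by (blast intro: mod_minus_cong mod_residue)

lift_definition minus_padic_int :: "'a padic_int \<Rightarrow> 'a padic_int \<Rightarrow> 'a padic_int"
  is "\<lambda>x y n. (x n - y n) mod int CARD('a) ^ n"
  unfolding mod_power_Suc_mod by (blast intro: mod_diff_cong mod_residue)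

instance
proof
  note rep_eqs = zero_padic_int.rep_eq one_padic_int.rep_eq plus_padic_int.rep_eq
    times_padic_int.rep_eq uminus_padic_int.rep_eq minus_padic_int.rep_eq
  fix a b c :: "'a padic_int"
  show "a * b * c = a * (b * c)"
    by (rule padic_int_eqI) (simp add: rep_eqs mod_simps algebra_simps)
  show "a * b = b * a"
    by (rule padic_int_eqI) (simp add: rep_eqs mod_simps algebra_simps)
  show "1 * a = a"
    by (rule padic_int_eqI) (simp add: rep_eqs mod_simps algebra_simps)
  show "a + b + c = a + (b + c)"
    by (rule padic_int_eqI) (simp add: rep_eqs mod_simps algebra_simps)
  show "a + b = b + a"
    by (rule padic_int_eqI) (simp add: rep_eqs mod_simps algebra_simps)
  show "0 + a = a"
    by (rule padic_int_eqI) (simp add: rep_eqs mod_simps algebra_simps)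
  show "- a + a = 0"
    by (rule padic_int_eqI) (simp add: rep_eqs mod_simps algebra_simps)
  show "a - b = a + - b"
    by (rule padic_int_eqI) (simp add: rep_eqs mod_simps algebra_simps)
  show "(a + b) * c = a * c + b * c"
    by (rule padic_int_eqI) (simp add: rep_eqs mod_simps algebra_simps)
  show "(0::'a padic_int) \<noteq> 1"
  proof transfer
    have "prime CARD('a)" by (rule prime_card)
    then have "1 mod int CARD('a) ^ 1 = 1"
      using prime_gt_1_nat[of "CARD('a)"] by simp
    then show "(\<lambda>_. 0) \<noteq> (\<lambda>n. 1 mod int CARD('a) ^ n)"
      by (metis zero_neq_one)
  qed
qed

end

lemma padic_int_residue_mod:
  fixes x :: "'p::prime_card padic_int"
  assumes "n \<le> m"
  shows "Rep_padic_int x m mod int CARD('p) ^ n = Rep_padic_int x n"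
  using assms
proof (induction m rule: dec_induct)
  case base
  show ?case by simp
next
  case (step m)
  have "Rep_padic_int x m = Rep_padic_int x (Suc m) mod int CARD('p) ^ m"
    using Rep_padic_int[of x] by blast
  moreover have "int CARD('p) ^ n dvd int CARD('p) ^ m"
    using step by (simp add: le_imp_power_dvd)
  ultimately show ?case
    using step.IH by (metis mod_mod_cancel)
qed

instance padic_int :: (prime_card) idom
proof
  fix x y :: "'a padic_int"
  let ?p = "int CARD('a)"
  have nz_residue: "\<exists>n. Rep_padic_int z n \<noteq> 0" if "z \<noteq> 0" for z :: "'a padic_int"
    using that padic_int_eqI[of z 0] by (auto simp: zero_padic_int.rep_eq)
  assume "x \<noteq> 0" "y \<noteq> 0"
  then obtain a b where a: "Rep_padic_int x a \<noteq> 0" and b: "Rep_padic_int y b \<noteq> 0"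
    using nz_residue by blast
  define X Y where "X = Rep_padic_int x (a + b)" and "Y = Rep_padic_int y (a + b)"
  have p: "prime ?p" using prime_card[where 'a = 'a] by simp
  have X: "\<not> ?p ^ a dvd X" and Y: "\<not> ?p ^ b dvd Y"
    using a b padic_int_residue_mod[of a "a + b" x] padic_int_residue_mod[of b "a + b" y]
    by (auto simp: X_def Y_def dvd_eq_mod_eq_0)
  then have nz: "X \<noteq> 0" "Y \<noteq> 0" by auto
  have u: "\<not> is_unit ?p" using p by (meson not_prime_unit)
  have "multiplicity ?p X < a" "multiplicity ?p Y < b"
    using X Y nz u by (auto simp: power_dvd_iff_le_multiplicity)
  moreover have "multiplicity ?p (X * Y) = multiplicity ?p X + multiplicity ?p Y"
    using p nz by (intro prime_elem_multiplicity_mult_distrib) auto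
  ultimately have "\<not> ?p ^ (a + b) dvd X * Y"
    using nz u by (auto simp: power_dvd_iff_le_multiplicity)
  then have "Rep_padic_int (x * y) (a + b) \<noteq> 0"
    by (simp add: times_padic_int.rep_eq X_def Y_def dvd_eq_mod_eq_0)
  then show "x * y \<noteq> 0"
    by (metis zero_padic_int.rep_eq)
qed

definition padic_val :: "'p::prime_card padic_int \<Rightarrow> enat" where
  "padic_val x = (SUP n \<in> {n. of_nat CARD('p) ^ n dvd x}. enat n)"

text \<open>The field of $p$-adic numbers is the fraction field of the $p$-adic integers.\<close>

type_synonym 'p padic = "'p padic_int fract"

definition of_padic_int :: "'p::prime_card padic_int \<Rightarrow> 'p padic" where
  "of_padic_int x = Fract x 1"

definition padic_ints :: "'p::prime_card padic set" where
  "padic_ints = range of_padic_int"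

definition int_vec :: "nat ^ 'd \<Rightarrow> int ^ 'd" where
  "int_vec n = (\<chi> i. int (n $ i))"

definition zero_extend :: "(nat ^ 'd \<Rightarrow> 'a::zero) \<Rightarrow> int ^ 'd \<Rightarrow> 'a" where
  "zero_extend A n = (if \<forall>i. 0 \<le> n $ i then A (\<chi> i. nat (n $ i)) else 0)"

end

theory Submission
  imports Defs "HOL-Number_Theory.Modular_Inverse"
begin

text \<open>
  Let \<open>S K s m\<close> be the sum over the box of side $p^s$ at $p^s m$. Applying (iii) to each summand and
  then regrouping the boxes of side $p^t$ into boxes of side $p^{t+1}$ gives, for all $t \le s$,
  \[ S(K + p^s m, s, m) \equiv \sum_{0 \le j < p^{s-t}} \frac{A(j + p^{s-t} m)}{A(j)}\, S(K, t, j)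
     \pmod{p^{s+1} g(m)}, \]
  where the step from $t$ to $t + 1$ uses the theorem for $t < s$ to control the error terms.
  For $t = s$ this reads $S(K + p^s m, s, m) \equiv A(m) A(0)^{-1} S(K, s, 0)$, so only $m = 0$ is left.
  The substitution $k \mapsto K - k$ shows that $\sum_m S(K, s, m) = 0$; in this sum all terms with
  $m \neq 0$ reduce to $S(K - p^s m, s, 0)$, and induction on the size of $K$ finishes the proof.
\<close>

section \<open>Units of the $p$-adic integers\<close>

lemma Rep_padic_int_of_nat:
  "Rep_padic_int (of_nat k :: 'p::prime_card padic_int) n = int k mod int CARD('p) ^ n"
  by (induction k)
    (simp_all add: zero_padic_int.rep_eq one_padic_int.rep_eq plus_padic_int.rep_eq mod_simps)

text \<open>If the residue mod p is 0, then p divides every later residue. Dividing a residue mod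
  p^(n+1) by p determines the quotient mod p^n only, hence the shift to
  \<open>Suc n\<close>.\<close>

lemma padic_int_prime_dvd:
  fixes x :: "'p::prime_card padic_int"
  assumes "Rep_padic_int x 1 = 0"
  shows "of_nat CARD('p) dvd x"
proof -
  let ?p = "int CARD('p)"
  define y where "y n = Rep_padic_int x (Suc n) div ?p" for n
  have "y n = y (Suc n) mod ?p ^ n" for n
  proof -
    have "Rep_padic_int x (Suc n) = Rep_padic_int x (Suc (Suc n)) mod (?p * ?p ^ n)"
      using padic_int_residue_mod[of "Suc n" "Suc (Suc n)" x] by simp
    also have "\<dots> = ?p * (y (Suc n) mod ?p ^ n) + Rep_padic_int x (Suc (Suc n)) mod ?p"
      unfolding y_def by (rule zmod_zmult2_eq) simp
    also have "Rep_padic_int x (Suc (Suc n)) mod ?p = 0"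
      using padic_int_residue_mod[of 1 "Suc (Suc n)" x] assms by simp
    finally show ?thesis by (simp add: y_def)
  qed
  then have Rep: "Rep_padic_int (Abs_padic_int y :: 'p padic_int) = y"
    by (intro Abs_padic_int_inverse) blast
  have "x = of_nat CARD('p) * Abs_padic_int y"
  proof (rule padic_int_eqI)
    fix n
    have "?p dvd Rep_padic_int x (Suc n)"
      using padic_int_residue_mod[of 1 "Suc n" x] assms by (simp add: dvd_eq_mod_eq_0)
    then have "?p * y n = Rep_padic_int x (Suc n)"
      by (simp add: y_def)
    then have "?p * y n mod ?p ^ n = Rep_padic_int x n"
      using padic_int_residue_mod[of n "Suc n" x] by simp
    then show "Rep_padic_int x n = Rep_padic_int (of_nat CARD('p) * Abs_padic_int y :: 'p padic_int) n"
      by (simp add: times_padic_int.rep_eq Rep_padic_int_of_nat Rep mod_simps)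
  qed
  then show ?thesis by (rule dvdI)
qed

text \<open>A nonzero residue mod p makes each residue coprime to p^n, so the inverse can be built
  level by level.\<close>

lemma padic_int_is_unit:
  fixes x :: "'p::prime_card padic_int"
  assumes "Rep_padic_int x 1 \<noteq> 0"
  shows "x dvd 1"
proof -
  let ?p = "int CARD('p)"
  have p: "prime ?p" using prime_card[where 'a = 'p] by simp
  have coprime: "coprime (Rep_padic_int x n) (?p ^ n)" for n
  proof (cases "n = 0")
    case False
    then have "Rep_padic_int x n mod ?p = Rep_padic_int x 1"
      using padic_int_residue_mod[of 1 n x] by simp
    with assms have "\<not> ?p dvd Rep_padic_int x n"
      by (auto simp: dvd_eq_mod_eq_0)
    then show ?thesis
      using p by (metis prime_imp_coprime coprime_commute coprime_power_right_iff)
  qed simp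
  define y where "y n = modular_inverse (?p ^ n) (Rep_padic_int x n)" for n
  have xy: "[Rep_padic_int x n * y n = 1] (mod ?p ^ n)" for n
    unfolding y_def using coprime by (rule cong_modular_inverse1)
  \<comment> \<open>The inverse at level n+1, reduced mod p^n, is also an inverse at level n;
    uniqueness of the reduced inverse makes the levels compatible.\<close>
  have "y n = y (Suc n) mod ?p ^ n" for n
  proof -
    have "[Rep_padic_int x n * (y (Suc n) mod ?p ^ n) = Rep_padic_int x (Suc n) * y (Suc n)] (mod ?p ^ n)"
      using padic_int_residue_mod[of n "Suc n" x]
      by (intro cong_mult) (auto simp: cong_def)
    also have "[Rep_padic_int x (Suc n) * y (Suc n) = 1] (mod ?p ^ n)"
      by (rule cong_dvd_modulus[OF xy[of "Suc n"]]) simp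
    finally show ?thesis
      unfolding y_def[of n] using p
      by (intro modular_inverse_int_eqI) (auto simp: prime_gt_0_int)
  qed
  then have Rep: "Rep_padic_int (Abs_padic_int y :: 'p padic_int) = y"
    by (intro Abs_padic_int_inverse) blast
  have "1 = x * Abs_padic_int y"
    using xy by (intro padic_int_eqI)
      (simp add: times_padic_int.rep_eq one_padic_int.rep_eq Rep cong_def)
  then show ?thesis by (rule dvdI)
qed

text \<open>Turns (i) into invertibility of A(0): a supremum equal to 0 excludes the exponent
  1.\<close>

lemma is_unit_if_padic_val_eq_0:
  fixes x :: "'p::prime_card padic_int"
  assumes "padic_val x = 0"
  shows "x dvd 1"
proof (rule padic_int_is_unit, rule notI)
  assume "Rep_padic_int x 1 = 0"
  then have "of_nat CARD('p) ^ 1 dvd x"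
    using padic_int_prime_dvd by simp
  then have "enat 1 \<le> padic_val x"
    unfolding padic_val_def by (intro SUP_upper) simp
  with assms show False by (simp add: zero_enat_def)
qed

section \<open>Boxes of integer vectors\<close>

text \<open>Stated by floor division, so that translating and subdividing boxes become identities
  for \<open>div\<close>. In particular \<open>box_at p s 0\<close> consists of the vectors with
  coordinates in [0, p^s).\<close>

definition box_at :: "nat \<Rightarrow> nat \<Rightarrow> int ^ 'd \<Rightarrow> (int ^ 'd) set" where
  "box_at p s m = {k. \<forall>i. k $ i div int p ^ s = m $ i}"

lemma div_eq_iff_bounds:
  fixes q k m :: int
  assumes "0 < q"
  shows "k div q = m \<longleftrightarrow> q * m \<le> k \<and> k < q * (m + 1)"
proof
  assume "k div q = m"
  then show "q * m \<le> k \<and> k < q * (m + 1)"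
    using mult_div_mod_eq[of q k] pos_mod_bound[OF assms, of k] pos_mod_sign[OF assms, of k]
    by (auto simp only: distrib_left mult_1_right)
next
  assume "q * m \<le> k \<and> k < q * (m + 1)"
  then show "k div q = m"
    by (intro int_div_pos_eq[of k q m "k - q * m"]) (auto simp: algebra_simps)
qed

lemma box_at_eq_interval:
  assumes "0 < p"
  shows "box_at p s m = {int p ^ s *s m .. int p ^ s *s (m + 1) - 1}"
  using assms
  by (auto simp: box_at_def div_eq_iff_bounds less_eq_vec_def)

lemma finite_vec_interval: "finite {a .. b :: int ^ 'd}"
proof (rule finite_subset)
  show "{a..b} \<subseteq> vec_lambda ` (PiE UNIV (\<lambda>i. {a $ i .. b $ i}))"
  proof
    fix x assume "x \<in> {a..b}"
    then have "vec_nth x \<in> PiE UNIV (\<lambda>i. {a $ i .. b $ i})"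
      by (auto simp: less_eq_vec_def)
    then show "x \<in> vec_lambda ` (PiE UNIV (\<lambda>i. {a $ i .. b $ i}))"
      by (metis image_eqI vec_nth_inverse)
  qed
qed (intro finite_imageI finite_PiE; simp)

lemma finite_box_at: "0 < p \<Longrightarrow> finite (box_at p s m)"
  by (simp add: box_at_eq_interval finite_vec_interval)

lemma box_at_0 [simp]: "box_at p 0 m = {m}"
  by (auto simp: box_at_def vec_eq_iff)

lemma box_at_nonneg:
  assumes "0 < p" "0 \<le> m" "k \<in> box_at p s m"
  shows "0 \<le> k"
proof -
  have "0 \<le> k $ i div int p ^ s" for i
    using assms(2,3) by (simp add: box_at_def less_eq_vec_def)
  then show ?thesis
    using assms(1) by (simp add: less_eq_vec_def pos_imp_zdiv_nonneg_iff)
qed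

lemma zero_mem_box_at: "0 \<in> box_at p s 0"
  by (simp add: box_at_def)

lemma box_at_add_iff:
  assumes "0 < p"
  shows "j + int p ^ s *s m \<in> box_at p s (l + m) \<longleftrightarrow> j \<in> box_at p s l"
  using assms by (simp add: box_at_def)

lemma box_at_eq_translate:
  assumes "0 < p"
  shows "box_at p s m = (\<lambda>j. j + int p ^ s *s m) ` box_at p s 0"
proof (intro equalityI subsetI)
  fix k assume "k \<in> box_at p s m"
  then have "k - int p ^ s *s m \<in> box_at p s 0"
    using box_at_add_iff[OF assms, of "k - int p ^ s *s m" s m 0] by simp
  then show "k \<in> (\<lambda>j. j + int p ^ s *s m) ` box_at p s 0"
    by (intro image_eqI[of _ _ "k - int p ^ s *s m"]) simp_all
qed (use box_at_add_iff[OF assms, of _ s m 0] in auto)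

lemma sum_box_at_translate:
  assumes "0 < p"
  shows "sum h (box_at p s m) = (\<Sum>j\<in>box_at p s 0. h (j + int p ^ s *s m))"
  unfolding box_at_eq_translate[OF assms, of s m]
  by (subst sum.reindex) (auto simp: inj_on_def)

text \<open>Group the points k by k div p^t. Since division by p^(s+t) is division by p^t followed
  by division by p^s, the groups are exactly the small boxes at the points j of
  \<open>box_at p s m\<close>.\<close>

lemma sum_box_at_split:
  fixes m :: "int ^ 'd"
  assumes "0 < p"
  shows "sum h (box_at p (s + t) m) = (\<Sum>j\<in>box_at p s m. \<Sum>k\<in>box_at p t j. h k)"
proof -
  let ?quot = "\<lambda>k::int ^ 'd. \<chi> i. k $ i div int p ^ t"
  have div: "k div int p ^ (s + t) = k div int p ^ t div int p ^ s" for k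
    by (simp add: power_add mult.commute[of "int p ^ s"] zdiv_zmult2_eq)
  have "sum h (box_at p (s + t) m)
      = (\<Sum>j\<in>box_at p s m. sum h {k \<in> box_at p (s + t) m. ?quot k = j})"
    using assms by (intro sum.group[symmetric] finite_box_at) (auto simp: box_at_def div)
  also have "\<dots> = (\<Sum>j\<in>box_at p s m. sum h (box_at p t j))"
    by (intro sum.cong refl) (auto simp: box_at_def div vec_eq_iff)
  finally show ?thesis .
qed

section \<open>Dwork's congruences over a subring of a field\<close>

text \<open>Abstracts Z_p inside Q_p to a subring \<open>R\<close> of a field, where the quotients
  in (iii) can be formed. The set \<open>c *o R\<close> is a principal fractional ideal, and
  \<open>A\<close> is already extended by zero to integer vectors.\<close>

locale dwork_congruence =
  fixes R :: "'f::field set" and p :: nat and A g :: "int ^ 'd \<Rightarrow> 'f" and a :: "int ^ 'd"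
  assumes one_mem: "1 \<in> R"
    and diff_mem: "x \<in> R \<Longrightarrow> y \<in> R \<Longrightarrow> x - y \<in> R"
    and mult_mem: "x \<in> R \<Longrightarrow> y \<in> R \<Longrightarrow> x * y \<in> R"
    and p_gt_1: "1 < p"
    and A_eq_0: "\<not> 0 \<le> n \<Longrightarrow> A n = 0"
    and A_neq_0: "0 \<le> n \<Longrightarrow> A n \<noteq> 0"
    and g_neq_0: "0 \<le> n \<Longrightarrow> g n \<noteq> 0"
    and g_mem: "0 \<le> n \<Longrightarrow> g n \<in> R"
    and inverse_A_0_mem: "inverse (A 0) \<in> R"
    and A_mem_ideal: "0 \<le> n \<Longrightarrow> A n \<in> g n *o R"
    and quotient_cong: "v \<in> box_at p 1 0 \<Longrightarrow> u \<in> box_at p s 0 \<Longrightarrow> 0 \<le> n \<Longrightarrow>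
      A (v + int p *s u + int p ^ (s + 1) *s n) / A (v + int p *s u) - A (u + int p ^ s *s n) / A u
      \<in> (of_nat p ^ (s + 1) * (g n / g (v + int p *s u))) *o R"
    and a_mem: "a \<in> box_at p 1 0"
begin

section \<open>Arithmetic in \<open>R\<close> and its principal fractional ideals\<close>

lemma zero_mem: "0 \<in> R"
  using diff_mem[OF one_mem one_mem] by simp

lemma add_mem: "x \<in> R \<Longrightarrow> y \<in> R \<Longrightarrow> x + y \<in> R"
  using diff_mem[of x "0 - y"] diff_mem[OF zero_mem, of y] by simp

lemma ideal_zero: "0 \<in> c *o R"
  using zero_mem by (force simp: elt_set_times_def)

lemma ideal_add: "x \<in> c *o R \<Longrightarrow> y \<in> c *o R \<Longrightarrow> x + y \<in> c *o R"
  by (auto simp: elt_set_times_def distrib_left[symmetric] intro: add_mem)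

lemma ideal_diff: "x \<in> c *o R \<Longrightarrow> y \<in> c *o R \<Longrightarrow> x - y \<in> c *o R"
  by (auto simp: elt_set_times_def right_diff_distrib[symmetric] intro: diff_mem)

lemma ideal_uminus: "x \<in> c *o R \<Longrightarrow> - x \<in> c *o R"
  using ideal_diff[OF ideal_zero] by fastforce

lemma ideal_sum: "(\<And>i. i \<in> I \<Longrightarrow> f i \<in> c *o R) \<Longrightarrow> sum f I \<in> c *o R"
  by (induction I rule: infinite_finite_induct) (auto intro: ideal_zero ideal_add)

lemma ideal_mult: "x \<in> c *o R \<Longrightarrow> y \<in> d *o R \<Longrightarrow> x * y \<in> (c * d) *o R"
proof -
  assume "x \<in> c *o R" "y \<in> d *o R"
  then obtain r r' where "r \<in> R" "r' \<in> R" "x = c * r" "y = d * r'"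
    by (auto simp: elt_set_times_def)
  then have "r * r' \<in> R" "x * y = c * d * (r * r')"
    by (auto intro: mult_mem)
  then show ?thesis by (auto simp: elt_set_times_def)
qed

lemma ideal_mult_left: "r \<in> R \<Longrightarrow> x \<in> c *o R \<Longrightarrow> r * x \<in> c *o R"
  using ideal_mult[of r 1 x c] by (simp add: elt_set_times_def)

lemma ideal_subset: "d \<in> R \<Longrightarrow> x \<in> (c * d) *o R \<Longrightarrow> x \<in> c *o R"
  by (auto simp: elt_set_times_def mult.assoc intro!: mult_mem)

lemma p_pos: "0 < p"
  using p_gt_1 by simp

lemma A_mem: "A n \<in> R"
  using A_mem_ideal[of n] A_eq_0[of n] zero_mem g_mem[of n]
  by (cases "0 \<le> n") (auto simp: elt_set_times_def intro: mult_mem)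

text \<open>Floor division by p recovers k from v + p k and preserves signs. Hence A(v + p k) and
  A(k) vanish for the same k.\<close>

lemma digit_shift_nonneg_iff:
  assumes "v \<in> box_at p 1 0"
  shows "0 \<le> v + int p *s k \<longleftrightarrow> 0 \<le> k"
proof -
  have "(v $ i + int p * k $ i) div int p = k $ i" for i
    using assms p_pos by (simp add: box_at_def)
  then have "0 \<le> v $ i + int p * k $ i \<longleftrightarrow> 0 \<le> k $ i" for i
    using p_pos pos_imp_zdiv_nonneg_iff[of "int p" "v $ i + int p * k $ i"] by simp
  then show ?thesis by (simp add: less_eq_vec_def)
qed

section \<open>The summands and their sums over boxes\<close>

definition T :: "int ^ 'd \<Rightarrow> int ^ 'd \<Rightarrow> 'f" where
  "T K k = A (a + int p *s k) * A (K - k) - A (a + int p *s (K - k)) * A k"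

definition S :: "int ^ 'd \<Rightarrow> nat \<Rightarrow> int ^ 'd \<Rightarrow> 'f" where
  "S K s m = (\<Sum>k\<in>box_at p s m. T K k)"

text \<open>If k or K - k has a negative coordinate, each of the two products contains a vanishing
  factor. So only finitely many k contribute for a given K.\<close>

lemma T_eq_0:
  assumes "\<not> (0 \<le> k \<and> k \<le> K)"
  shows "T K k = 0"
proof (cases "0 \<le> k")
  case False
  then show ?thesis
    using digit_shift_nonneg_iff[OF a_mem, of k] by (simp add: T_def A_eq_0)
next
  case True
  with assms have "\<not> 0 \<le> K - k" by (auto simp: less_eq_vec_def)
  then show ?thesis
    using digit_shift_nonneg_iff[OF a_mem, of "K - k"] by (simp add: T_def A_eq_0)
qed

text \<open>Reindexing by k -> K - k carries one product sum into the other; they cancel directly,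
  even in characteristic 2.\<close>

lemma sum_T_eq_0: "(\<Sum>k\<in>{0..K}. T K k) = 0"
proof -
  have bij: "bij_betw (\<lambda>k. K - k) {0..K} {0..K}"
    by (rule bij_betwI[where g = "\<lambda>k. K - k"]) (auto simp: less_eq_vec_def)
  have 1: "(\<Sum>k\<in>{0..K}. A (a + int p *s k) * A (K - k))
      = (\<Sum>k\<in>{0..K}. A (a + int p *s (K - k)) * A k)"
    by (subst sum.reindex_bij_betw[OF bij, symmetric]) simp
  show ?thesis by (simp add: T_def sum_subtractf 1)
qed

lemma S_eq_0: "\<not> 0 \<le> K \<Longrightarrow> S K s m = 0"
  unfolding S_def by (intro sum.neutral ballI T_eq_0) (auto dest: order_trans)

lemma S_split: "S K (s + t) m = (\<Sum>j\<in>box_at p s m. S K t j)"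
  unfolding S_def using p_pos by (rule sum_box_at_split)

text \<open>Here t measures how far the boxes have been merged; the last premise is the main
  congruence for exponents below t. At t = s only j = 0 remains.\<close>

lemma S_shift_cong:
  assumes "0 \<le> m" "t \<le> s"
    and "\<And>u j. u < t \<Longrightarrow> 0 \<le> j \<Longrightarrow> S K u j \<in> (of_nat p ^ (u + 1) * g j) *o R"
  shows "S (K + int p ^ s *s m) s m
      - (\<Sum>j\<in>box_at p (s - t) 0. A (j + int p ^ (s - t) *s m) / A j * S K t j)
    \<in> (of_nat p ^ (s + 1) * g m) *o R"
  using assms(2,3)
proof (induction t)
  case 0
  have "S (K + int p ^ s *s m) s m
      = (\<Sum>j\<in>box_at p s 0. T (K + int p ^ s *s m) (j + int p ^ s *s m))"
    unfolding S_def using p_pos by (rule sum_box_at_translate)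
  moreover have "T (K + int p ^ s *s m) (j + int p ^ s *s m) - A (j + int p ^ s *s m) / A j * T K j
      \<in> (of_nat p ^ (s + 1) * g m) *o R" if j: "j \<in> box_at p s 0" for j
  proof -
    let ?w = "a + int p *s j"
    have j0: "0 \<le> j" using box_at_nonneg[OF p_pos _ j] by simp
    then have w0: "0 \<le> ?w" using digit_shift_nonneg_iff[OF a_mem] by simp
    have eq: "a + int p *s (j + int p ^ s *s m) = ?w + int p ^ (s + 1) *s m"
      by (simp add: vec_eq_iff algebra_simps)
    \<comment> \<open>Shifting K and j together leaves K - j fixed. The second products then cancel
      exactly, so the error comes from the first product alone and is an instance of (iii) with v =
      a and u = j.\<close>
    have "T (K + int p ^ s *s m) (j + int p ^ s *s m) - A (j + int p ^ s *s m) / A j * T K j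
      = A (K - j) * (A ?w * (A (?w + int p ^ (s + 1) *s m) / A ?w - A (j + int p ^ s *s m) / A j))"
      unfolding T_def eq using A_neq_0[OF j0] A_neq_0[OF w0] by (simp add: field_simps)
    \<comment> \<open>The factor A(w), a multiple of g(w), clears the denominator g(w) in
      (iii).\<close>
    moreover have "A ?w * (A (?w + int p ^ (s + 1) *s m) / A ?w - A (j + int p ^ s *s m) / A j)
        \<in> (g ?w * (of_nat p ^ (s + 1) * (g m / g ?w))) *o R"
      by (intro ideal_mult A_mem_ideal[OF w0] quotient_cong[OF a_mem j assms(1)])
    moreover have "g ?w * (of_nat p ^ (s + 1) * (g m / g ?w)) = of_nat p ^ (s + 1) * g m"
      using g_neq_0[OF w0] by simp
    ultimately show ?thesis
      by (simp add: ideal_mult_left A_mem)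
  qed
  ultimately show ?case
    by (simp add: S_def sum_subtractf[symmetric] ideal_sum)
next
  case (Suc t)
  define r where "r = s - Suc t"
  have r: "s - t = r + 1" "s = r + t + 1" using Suc.prems(1) by (auto simp: r_def)
  define c where "c r j = A (j + int p ^ r *s m) / A j" for r j
  \<comment> \<open>Both sums are written over pairs (u, j) with j = v + p u, v a digit vector. The
    coefficients then differ by the left side of (iii) at exponent r.\<close>
  have "(\<Sum>j\<in>box_at p (r + 1) 0. c (r + 1) j * S K t j) - (\<Sum>u\<in>box_at p r 0. c r u * S K (Suc t) u)
      = (\<Sum>u\<in>box_at p r 0. \<Sum>j\<in>box_at p 1 u. (c (r + 1) j - c r u) * S K t j)"
    unfolding sum_box_at_split[OF p_pos] S_split[of K 1 t, simplified]
    by (simp add: sum_subtractf[symmetric] sum_distrib_left left_diff_distrib)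
  also have "\<dots> \<in> (of_nat p ^ (s + 1) * g m) *o R"
  proof (intro ideal_sum)
    fix u j :: "int ^ 'd"
    assume u: "u \<in> box_at p r 0" and j: "j \<in> box_at p 1 u"
    have j0: "0 \<le> j"
      using box_at_nonneg[OF p_pos _ j] box_at_nonneg[OF p_pos _ u] by simp
    obtain v where v: "v \<in> box_at p 1 0" "j = v + int p *s u"
      using j box_at_eq_translate[OF p_pos, of 1 u] by auto
    have "(c (r + 1) j - c r u) * S K t j
        \<in> (of_nat p ^ (r + 1) * (g m / g j) * (of_nat p ^ (t + 1) * g j)) *o R"
      unfolding v(2) c_def
      by (intro ideal_mult quotient_cong v u assms(1) Suc.prems(2)[of t] j0[unfolded v(2)] lessI)
    \<comment> \<open>The bound from (iii) has g(j) in its denominator and the premise on S(K, t, j)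
      supplies g(j); the powers of p add up to (r + 1) + (t + 1) = s + 1.\<close>
    also have "of_nat p ^ (r + 1) * (g m / g j) * (of_nat p ^ (t + 1) * g j)
        = of_nat p ^ (s + 1) * g m"
      using g_neq_0[OF j0] by (simp add: r(2) power_add)
    finally show "(c (r + 1) j - c r u) * S K t j \<in> (of_nat p ^ (s + 1) * g m) *o R" .
  qed
  finally have "(\<Sum>j\<in>box_at p (r + 1) 0. c (r + 1) j * S K t j)
      - (\<Sum>u\<in>box_at p r 0. c r u * S K (Suc t) u) \<in> (of_nat p ^ (s + 1) * g m) *o R" .
  moreover have "S (K + int p ^ s *s m) s m - (\<Sum>j\<in>box_at p (r + 1) 0. c (r + 1) j * S K t j)
      \<in> (of_nat p ^ (s + 1) * g m) *o R"
    using Suc.IH Suc.prems by (simp add: r(1) c_def)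
  ultimately show ?case
    unfolding r_def[symmetric] c_def by (auto dest: ideal_add)
qed

text \<open>The boxes of side p^s tile one large box containing all k with 0 \<le> k \<le> K, and
  the summands outside that range vanish.\<close>

lemma sum_S_eq_0:
  assumes "0 \<le> K"
  shows "\<exists>r. (\<Sum>m\<in>box_at p r 0. S K s m) = 0"
proof -
  \<comment> \<open>The coordinate sum bounds every coordinate of K, and r < p^r, so this exponent
    is large enough.\<close>
  define r where "r = nat (\<Sum>i\<in>UNIV. K $ i)"
  have less: "k $ i < int p ^ (r + s)" if "0 \<le> k" "k \<le> K" for k i
  proof -
    have "k $ i \<le> K $ i" using that by (simp add: less_eq_vec_def)
    also have "K $ i \<le> (\<Sum>i\<in>UNIV. K $ i)"
      using assms by (intro member_le_sum) (auto simp: less_eq_vec_def)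
    also have "\<dots> \<le> int r" by (simp add: r_def)
    also have "\<dots> < int (p ^ r)"
      using p_gt_1 by (simp only: of_nat_less_iff less_exp power_gt_expt)
    also have "\<dots> \<le> int p ^ (r + s)"
      using p_gt_1 by (simp add: power_increasing)
    finally show ?thesis .
  qed
  have "(\<Sum>m\<in>box_at p r 0. S K s m) = (\<Sum>k\<in>box_at p (r + s) 0. T K k)"
    unfolding S_def by (rule sum_box_at_split[OF p_pos, symmetric])
  also have "\<dots> = (\<Sum>k\<in>{0..K}. T K k)"
  proof (rule sum.mono_neutral_right)
    show "{0..K} \<subseteq> box_at p (r + s) 0"
      using less by (auto simp: box_at_def less_eq_vec_def)
  qed (auto simp: T_eq_0 finite_box_at p_pos)
  finally show ?thesis using sum_T_eq_0 by auto
qed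

lemma S_mem_ideal:
  assumes "0 \<le> m"
  shows "S K s m \<in> (of_nat p ^ (s + 1) * g m) *o R"
  using assms
proof (induction s arbitrary: K m rule: less_induct)
  case (less s)
  \<comment> \<open>The case t = s of \<open>S_shift_cong\<close>, whose premise is the induction
    hypothesis on s.\<close>
  have cong: "S (K + int p ^ s *s m) s m - A m / A 0 * S K s 0 \<in> (of_nat p ^ (s + 1) * g m) *o R"
    if "0 \<le> m" for K m
    using S_shift_cong[OF that order_refl, of s K] less.IH by simp
  have reduce: "S (K + int p ^ s *s m) s m \<in> (of_nat p ^ (s + 1) * g m) *o R"
    if m: "0 \<le> m" and K: "S K s 0 \<in> of_nat p ^ (s + 1) *o R" for K m
  proof -
    have "inverse (A 0) * (A m * S K s 0) \<in> (g m * of_nat p ^ (s + 1)) *o R"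
      by (intro ideal_mult_left ideal_mult inverse_A_0_mem A_mem_ideal m K)
    then have "A m / A 0 * S K s 0 \<in> (of_nat p ^ (s + 1) * g m) *o R"
      by (simp add: field_simps)
    from ideal_add[OF cong[OF m, of K] this] show ?thesis by simp
  qed
  \<comment> \<open>Only p^(s+1) is claimed at m = 0; the factor g(m), including g(0), is restored
    by \<open>reduce\<close>. The inner induction is on the coordinate sum of K.\<close>
  have base: "S K s 0 \<in> of_nat p ^ (s + 1) *o R" for K
  proof (induction "nat (\<Sum>i\<in>UNIV. K $ i)" arbitrary: K rule: less_induct)
    case (less K)
    show ?case
    proof (cases "0 \<le> K")
      case False
      then show ?thesis by (simp add: S_eq_0 ideal_zero)
    next
      case True
      obtain r where "(\<Sum>m\<in>box_at p r 0. S K s m) = 0"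
        using sum_S_eq_0[OF True] by blast
      then have "S K s 0 = - (\<Sum>m\<in>box_at p r 0 - {0}. S K s m)"
        by (subst (asm) sum.remove[OF finite_box_at[OF p_pos] zero_mem_box_at])
          (simp add: eq_neg_iff_add_eq_0)
      also have "\<dots> \<in> of_nat p ^ (s + 1) *o R"
      proof (intro ideal_uminus ideal_sum)
        fix m :: "int ^ 'd"
        assume m: "m \<in> box_at p r 0 - {0}"
        then have m0: "0 \<le> m" using box_at_nonneg[OF p_pos order_refl, of m r] by simp
        let ?K = "K - int p ^ s *s m"
        have "(\<Sum>i\<in>UNIV. ?K $ i) < (\<Sum>i\<in>UNIV. K $ i)"
        proof (rule sum_strict_mono_ex1)
          obtain i where "m $ i \<noteq> 0" using m by (auto simp: vec_eq_iff)
          with m0 have "0 < m $ i" by (simp add: less_eq_vec_def order_less_le)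
          then show "\<exists>i\<in>UNIV. ?K $ i < K $ i"
            using p_pos by (intro bexI[of _ i]) simp_all
        qed (use m0 in \<open>auto simp: less_eq_vec_def\<close>)
        \<comment> \<open>Since \<open>nat\<close> truncates at 0, the measure drops strictly only
          if the old coordinate sum is positive; a non-negative smaller sum ensures this.\<close>
        moreover have "0 < (\<Sum>i\<in>UNIV. K $ i)" if "0 \<le> ?K"
          using that calculation sum_nonneg[of UNIV "\<lambda>i. ?K $ i"] by (simp add: less_eq_vec_def)
        ultimately have "S ?K s 0 \<in> of_nat p ^ (s + 1) *o R" if "0 \<le> ?K"
          using that by (intro less) simp
        moreover have "S ?K s 0 \<in> of_nat p ^ (s + 1) *o R" if "\<not> 0 \<le> ?K"
          using that by (simp add: S_eq_0 ideal_zero)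
        \<comment> \<open>Shifting \<open>?K\<close> back by p^s m gives K, so \<open>reduce\<close>
          applies; afterwards the factor g(m) is absorbed into \<open>R\<close>.\<close>
        ultimately have "S K s m \<in> (of_nat p ^ (s + 1) * g m) *o R"
          using reduce[OF m0, of ?K] by auto
        then show "S K s m \<in> of_nat p ^ (s + 1) *o R"
          using g_mem[OF m0] by (rule ideal_subset[rotated])
      qed
      finally show ?thesis .
    qed
  qed
  show ?case
    using reduce[OF less.prems base, of "K - int p ^ s *s m"] by simp
qed

end

section \<open>Multivariate Dwork congruences for $p$-adic integers\<close>

lemma of_padic_int_simps:
  "of_padic_int 0 = 0" "of_padic_int 1 = 1" "of_padic_int (of_nat k) = of_nat k"
  "of_padic_int (x + y) = of_padic_int x + of_padic_int y"
  "of_padic_int (x - y) = of_padic_int x - of_padic_int y"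
  "of_padic_int (x * y) = of_padic_int x * of_padic_int y"
  by (simp_all add: of_padic_int_def Zero_fract_def One_fract_def Fract_of_nat_eq)

lemma of_padic_int_eq_iff: "of_padic_int x = of_padic_int y \<longleftrightarrow> x = y"
  by (simp add: of_padic_int_def eq_fract)

lemma of_padic_int_power: "of_padic_int (x ^ n) = of_padic_int x ^ n"
  by (induction n) (simp_all add: of_padic_int_simps)

lemma of_padic_int_sum: "of_padic_int (sum f I) = (\<Sum>i\<in>I. of_padic_int (f i))"
  by (induction I rule: infinite_finite_induct) (simp_all add: of_padic_int_simps)

text \<open>Injectivity of the embedding lets a congruence proved in Q_p descend to Z_p.\<close>

lemma of_padic_int_mem_ideal_iff:
  "of_padic_int x \<in> of_padic_int c *o padic_ints \<longleftrightarrow> x \<in> c *o UNIV"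
  by (auto simp: elt_set_times_def padic_ints_def of_padic_int_simps(6)[symmetric] of_padic_int_eq_iff)

definition nat_vec :: "int ^ 'd \<Rightarrow> nat ^ 'd" where
  "nat_vec n = (\<chi> i. nat (n $ i))"

lemma nat_vec_int_vec [simp]: "nat_vec (int_vec n) = n"
  by (simp add: nat_vec_def int_vec_def vec_eq_iff)

lemma int_vec_nonneg: "0 \<le> int_vec n"
  by (simp add: int_vec_def less_eq_vec_def)

lemma nonneg_obtain_int_vec:
  assumes "0 \<le> n"
  obtains n' where "n = int_vec n'"
proof
  show "n = int_vec (nat_vec n)"
    using assms by (simp add: nat_vec_def int_vec_def vec_eq_iff less_eq_vec_def)
qed

lemma int_vec_add: "int_vec (m + n) = int_vec m + int_vec n"
  and int_vec_scale: "int_vec (c *s n) = int c *s int_vec n"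
  by (simp_all add: int_vec_def vec_eq_iff)

lemma zero_extend_int_vec [simp]: "zero_extend A (int_vec n) = A n"
  by (simp add: zero_extend_def int_vec_def)

lemma zero_extend_eq_0: "\<not> 0 \<le> n \<Longrightarrow> zero_extend A n = 0"
  by (auto simp: zero_extend_def less_eq_vec_def)

lemma int_vec_mem_box_at_0_iff:
  assumes "0 < p"
  shows "int_vec n \<in> box_at p s 0 \<longleftrightarrow> (\<forall>i. n $ i < p ^ s)"
proof -
  have "int k < int p ^ s \<longleftrightarrow> k < p ^ s" for k
    by (metis of_nat_less_iff of_nat_power)
  then show ?thesis
    using assms by (simp add: box_at_def int_vec_def div_eq_iff_bounds)
qed

theorem theorem1:
  fixes p :: nat
    and A g :: "nat ^ 'd \<Rightarrow> 'p::prime_card padic_int"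
  assumes "p = CARD('p)"
    and "\<And>n. A n \<noteq> 0"
    and "\<And>n. g n \<noteq> 0"
    and "padic_val (A 0) = 0"
    and "\<And>n. A n \<in> g n *o UNIV"
    and "\<And>(s::nat) v u n. (\<forall>i. v $ i < p) \<Longrightarrow> (\<forall>i. u $ i < p ^ s) \<Longrightarrow>
      of_padic_int (A (v + p *s u + p ^ (s + 1) *s n)) / of_padic_int (A (v + p *s u))
        - of_padic_int (A (u + p ^ s *s n)) / of_padic_int (A u)
      \<in> (of_nat p ^ (s + 1) * (of_padic_int (g n) / of_padic_int (g (v + p *s u)))) *o padic_ints"
  shows "\<forall>(s::nat) (m::nat ^ 'd) (K::int ^ 'd) (a::nat ^ 'd). (\<forall>i. a $ i < p) \<longrightarrow>
    (\<Sum>k \<in> {int p ^ s *s int_vec m .. int p ^ s *s (int_vec m + 1) - 1}.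
        zero_extend A (int_vec a + int p *s k) * zero_extend A (K - k)
        - zero_extend A (int_vec a + int p *s (K - k)) * zero_extend A k)
    \<in> (of_nat p ^ (s + 1) * g m) *o UNIV"
proof (intro allI impI)
  fix s :: nat and m a :: "nat ^ 'd" and K :: "int ^ 'd"
  assume a: "\<forall>i. a $ i < p"
  have p: "1 < p" using prime_card[where 'a = 'p] assms(1) prime_gt_1_nat by blast
  define A' where "A' n = of_padic_int (zero_extend A n)" for n
  \<comment> \<open>Unlike \<open>A\<close>, which is extended by zero, \<open>g\<close> is extended
    by clipping negative coordinates to 0.\<close>
  define g' where "g' n = of_padic_int (g (nat_vec n))" for n
  have A'_int_vec: "A' (int_vec n) = of_padic_int (A n)"
    and g'_int_vec: "g' (int_vec n) = of_padic_int (g n)" for n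
    by (simp_all add: A'_def g'_def)
  have int_vec_0: "(0 :: int ^ 'd) = int_vec 0" by (simp add: int_vec_def vec_eq_iff)
  interpret dwork_congruence padic_ints p A' g' "int_vec a"
  proof
    show "1 \<in> (padic_ints :: 'p padic set)"
      unfolding padic_ints_def by (metis of_padic_int_simps(2) rangeI)
    show "x - y \<in> padic_ints" "x * y \<in> padic_ints"
      if "x \<in> padic_ints" "y \<in> padic_ints" for x y :: "'p padic"
      using that by (auto simp: padic_ints_def of_padic_int_simps(5,6)[symmetric])
    show "1 < p" by (fact p)
    show "A' n = 0" if "\<not> 0 \<le> n" for n
      using that by (simp add: A'_def zero_extend_eq_0 of_padic_int_simps)
    show "A' n \<noteq> 0" "g' n \<noteq> 0" "g' n \<in> padic_ints" "A' n \<in> g' n *o padic_ints"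
      if n: "0 \<le> n" for n
    proof -
      obtain n' where n': "n = int_vec n'" using n by (rule nonneg_obtain_int_vec)
      show "A' n \<noteq> 0" "g' n \<noteq> 0"
        unfolding n' A'_int_vec g'_int_vec of_padic_int_simps(1)[symmetric] of_padic_int_eq_iff
        by (fact assms)+
      show "g' n \<in> padic_ints"
        by (simp add: g'_def padic_ints_def)
      show "A' n \<in> g' n *o padic_ints"
        unfolding n' A'_int_vec g'_int_vec of_padic_int_mem_ideal_iff by (fact assms)
    qed
    \<comment> \<open>The unit inverse of A(0) in Z_p maps to its field inverse, which therefore
      lies in \<open>padic_ints\<close>.\<close>
    obtain b where "1 = A 0 * b"
      using is_unit_if_padic_val_eq_0[OF assms(4)] by (rule dvdE)
    then have "A' 0 * of_padic_int b = 1"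
      by (simp add: int_vec_0 A'_int_vec of_padic_int_simps(2,6)[symmetric])
    then have "inverse (A' 0) = of_padic_int b"
      by (metis inverse_unique)
    then show "inverse (A' 0) \<in> padic_ints"
      by (simp add: padic_ints_def)
    show "int_vec a \<in> box_at p 1 0"
      using a p by (simp add: int_vec_mem_box_at_0_iff)
    fix v u n :: "int ^ 'd" and s :: nat
    assume v: "v \<in> box_at p 1 0" and u: "u \<in> box_at p s 0" and n: "0 \<le> n"
    have "0 \<le> v" "0 \<le> u"
      using p box_at_nonneg[OF _ _ v] box_at_nonneg[OF _ _ u] by simp_all
    with n obtain v' u' n' where eqs: "v = int_vec v'" "u = int_vec u'" "n = int_vec n'"
      by (metis nonneg_obtain_int_vec)
    have "\<forall>i. v' $ i < p" "\<forall>i. u' $ i < p ^ s"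
      using v u p by (simp_all add: eqs int_vec_mem_box_at_0_iff)
    from assms(6)[OF this, of n']
    show "A' (v + int p *s u + int p ^ (s + 1) *s n) / A' (v + int p *s u)
        - A' (u + int p ^ s *s n) / A' u
      \<in> (of_nat p ^ (s + 1) * (g' n / g' (v + int p *s u))) *o padic_ints"
      unfolding eqs of_nat_power[where 'a = int, symmetric] int_vec_scale[symmetric] int_vec_add[symmetric]
        A'_int_vec g'_int_vec .
  qed
  let ?sum = "\<Sum>k \<in> {int p ^ s *s int_vec m .. int p ^ s *s (int_vec m + 1) - 1}.
        zero_extend A (int_vec a + int p *s k) * zero_extend A (K - k)
        - zero_extend A (int_vec a + int p *s (K - k)) * zero_extend A k"
  have "of_padic_int ?sum = S K s (int_vec m)"
    using p by (simp add: S_def T_def A'_def box_at_eq_interval of_padic_int_sum of_padic_int_simps)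
  then have "of_padic_int ?sum \<in> of_padic_int (of_nat p ^ (s + 1) * g m) *o padic_ints"
    using S_mem_ideal[OF int_vec_nonneg, of K s m]
    by (simp only: g'_int_vec of_padic_int_simps of_padic_int_power)
  then show "?sum \<in> (of_nat p ^ (s + 1) * g m) *o UNIV"
    by (simp only: of_padic_int_mem_ideal_iff)
qed

end
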